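(* There exist a partition $p:[\omega_1]^2\to\omega$ with injective fibers and a coloring $c:[\omega_1]^2\to\omega$ such that for every $k<\omega$ and every $X\subseteq\omega_1$ of order type $\omega+k$ there exists $j<\omega$ with $|\{c(\alpha,\beta)\mid(\alpha,\beta)\in[X]^2\ \&\ p(\alpha,\beta)=j\}|\ge k$.
   Context: $[A]^2$ denotes pairs $(\alpha,\beta)$ from $A$ with $\alpha<\beta$. $p$ has injective fibers iff $p(\alpha,\beta)\ne p(\alpha',\beta)$ whenever $\alpha<\alpha'<\beta<\omega_1$. *)

theory Defs
  imports Main
begin

unbundle cardinal_syntax

definition omega1 :: "nat set rel" where
  "omega1 = cardSuc natLeq"

text \<open>The set \<open>[A]\<^sup>2\<close>, for the reflexive well-order \<open>r\<close>.\<close>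

definition inc_pairs :: "'a rel \<Rightarrow> 'a set \<Rightarrow> ('a \<times> 'a) set" where
  "inc_pairs r A = {(\<alpha>, \<beta>). \<alpha> \<in> A \<and> \<beta> \<in> A \<and> (\<alpha>, \<beta>) \<in> r - Id}"

text \<open>Only the values of \<open>p\<close> on \<^term>\<open>inc_pairs r (Field r)\<close> are constrained.\<close>

definition injective_fibers :: "'a rel \<Rightarrow> ('a \<times> 'a \<Rightarrow> 'b) \<Rightarrow> bool" where
  "injective_fibers r p \<longleftrightarrow>
     (\<forall>\<alpha> \<alpha>' \<beta>. (\<alpha>, \<alpha>') \<in> r - Id \<longrightarrow> (\<alpha>', \<beta>) \<in> r - Id \<longrightarrow> p (\<alpha>, \<beta>) \<noteq> p (\<alpha>', \<beta>))"

text \<open>The ordinal \<open>\<omega> + k\<close>: the points \<^term>\<open>Inr i\<close> with \<open>i < k\<close> lie above all points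
  \<^term>\<open>Inl n\<close>.\<close>

definition omega_plus :: "nat \<Rightarrow> (nat + nat) rel" where
  "omega_plus k =
     {(Inl m, Inl n) | m n. m \<le> n} \<union>
     {(Inl m, Inr i) | m i. i < k} \<union>
     {(Inr i, Inr j) | i j. i \<le> j \<and> j < k}"

definition has_order_type :: "'a rel \<Rightarrow> 'a set \<Rightarrow> 'b rel \<Rightarrow> bool" where
  "has_order_type r X s \<longleftrightarrow> X \<subseteq> Field r \<and> Restr r X =o s"

lemma Field_omega_plus: "Field (omega_plus k) = range Inl \<union> Inr ` {..<k}"
  by (force simp: Field_def omega_plus_def)

lemma Well_order_omega_plus: "Well_order (omega_plus k)"
proof -
  let ?f = "\<lambda>x::nat + nat. case x of Inl n \<Rightarrow> (0::nat, n) | Inr i \<Rightarrow> (1, i)"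
  have "omega_plus k - Id \<subseteq> inv_image (less_than <*lex*> less_than) ?f"
    by (auto simp: omega_plus_def)
  then have "wf (omega_plus k - Id)"
    by (rule wf_subset[rotated]) auto
  moreover have "omega_plus k \<subseteq> Field (omega_plus k) \<times> Field (omega_plus k)"
    by (auto simp: Field_def)
  moreover have "refl_on (Field (omega_plus k)) (omega_plus k)"
    unfolding refl_on_def Field_omega_plus by (auto simp: omega_plus_def)
  moreover have "trans (omega_plus k)"
    by (rule transI) (auto simp: omega_plus_def)
  moreover have "antisym (omega_plus k)"
    by (rule antisymI) (auto simp: omega_plus_def)
  moreover have "total_on (Field (omega_plus k)) (omega_plus k)"
    unfolding total_on_def Field_omega_plus by (auto simp: omega_plus_def)
  ultimately show ?thesis
    unfolding well_order_on_def linear_order_on_def partial_order_on_def preorder_on_def by blast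
qed

lemma Card_order_omega1: "Card_order omega1"
  by (simp add: omega1_def cardSuc_Card_order natLeq_Card_order)

lemma ex_has_order_type_omega_plus: "\<exists>X. has_order_type omega1 X (omega_plus k)"
proof -
  have wo: "Well_order omega1"
    using Card_order_omega1 by (rule card_order_on_well_order_on)
  have "|Field (omega_plus k)| \<le>o |UNIV :: (nat + nat) set|"
    by (rule card_of_mono1) simp
  also have "|UNIV :: (nat + nat) set| \<le>o |UNIV :: nat set|"
    using card_of_Plus_infinite1[OF infinite_UNIV_nat card_of_mono1[OF subset_UNIV],
      of "UNIV :: nat set"]
    by (simp add: ordIso_imp_ordLeq)
  also have "|UNIV :: nat set| =o natLeq"
    by (rule card_of_nat)
  also have "natLeq <o omega1"
    unfolding omega1_def by (rule cardSuc_greater[OF natLeq_Card_order])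
  finally have less: "|Field (omega_plus k)| <o omega1" .
  have "omega_plus k <o omega1"
  proof (rule ccontr)
    assume "\<not> ?thesis"
    then have "omega1 \<le>o omega_plus k"
      using wo Well_order_omega_plus not_ordLess_iff_ordLeq by blast
    then have "|Field omega1| \<le>o |Field (omega_plus k)|"
      by (rule card_of_mono2)
    moreover have "omega1 =o |Field omega1|"
      using card_of_Field_ordIso[OF Card_order_omega1] by (rule ordIso_symmetric)
    ultimately have "omega1 \<le>o |Field (omega_plus k)|"
      by (rule ordIso_ordLeq_trans[rotated])
    with less show False
      using not_ordLess_ordLeq by blast
  qed
  then obtain a where "omega_plus k =o Restr omega1 (underS omega1 a)"
    using ordLess_iff_ordIso_Restr[OF wo Well_order_omega_plus] by blast
  moreover have "underS omega1 a \<subseteq> Field omega1"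
    by (auto simp: underS_def Field_def)
  ultimately show ?thesis
    unfolding has_order_type_def using ordIso_symmetric by blast
qed

end

theory Submission
  imports Defs "HOL-Library.Countable_Set" "HOL-Library.Nat_Bijection"
begin

text \<open>Take a coherent sequence of injections \<open>p(\<cdot>, \<beta>) : \<beta> \<rightarrow> \<omega>\<close>, that is, one in which
  \<open>p(\<cdot>, \<gamma>)\<close> and \<open>p(\<cdot>, \<beta>)\<close> differ at only finitely many points below \<open>\<gamma> < \<beta>\<close>.
  Fix distinct subsets \<open>r\<^sub>\<beta>\<close> of \<open>\<omega>\<close> and let \<open>c(\<alpha>, \<beta>)\<close> code the initial segment
  \<open>r\<^sub>\<beta> \<inter> p(\<alpha>, \<beta>)\<close>. If \<open>X\<close> consists of \<open>x\<^sub>0 < x\<^sub>1 < \<dots>\<close> followed by \<open>b\<^sub>0 < \<dots> < b\<^bsub>k-1\<^esub>\<close>, then for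
  all but finitely many \<open>n\<close> the values \<open>p(x\<^sub>n, b\<^sub>i)\<close> are one and the same number \<open>j\<close>, and \<open>j\<close> is
  so large that the sets \<open>r\<^bsub>b\<^sub>i\<^esub> \<inter> j\<close> are pairwise distinct.

  The coherent injections come from a coherent sequence of finite-to-one functions, by recording
  together with each value the number of earlier arguments that take this value.\<close>

section \<open>Initial segments of a well-order\<close>

lemma underS_trans:
  assumes "Well_order r" "\<alpha> \<in> underS r \<beta>" "\<beta> \<in> underS r \<gamma>"
  shows "\<alpha> \<in> underS r \<gamma>"
proof -
  have "Linear_order r" "(\<beta>, \<gamma>) \<in> r"
    using assms by (simp_all add: well_order_on_def underS_def)
  then have "underS r \<beta> \<subseteq> underS r \<gamma>"
    using underS_incl_iff[of r \<beta> \<gamma>] by (auto simp: Field_def)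
  with assms(2) show ?thesis by blast
qed

lemma underS_linear:
  assumes "Well_order r" "\<alpha> \<in> underS r \<beta>" "\<alpha>' \<in> underS r \<beta>" "\<alpha> \<noteq> \<alpha>'"
  shows "\<alpha> \<in> underS r \<alpha>' \<or> \<alpha>' \<in> underS r \<alpha>"
proof -
  have "\<alpha> \<in> Field r" "\<alpha>' \<in> Field r"
    using assms by (auto simp: underS_def Field_def)
  with assms(4) wo_rel.TOTALS[of r] assms(1) show ?thesis
    by (auto simp: underS_def wo_rel_def)
qed

section \<open>Coherent sequences over a well-order with countable initial segments\<close>

text \<open>A variant of Todorcevic's \<open>\<rho>\<^sub>1\<close>:
  \<open>e \<alpha> \<beta>\<close> is the largest weight met on a walk from \<beta> down to
  \<alpha>. Each step goes to the first point at or above \<alpha> in a fixed enumeration of the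
  predecessors, and its weight is the index of that point.\<close>

lemma ex_coherent_finite_to_one:
  fixes r :: "'a rel"
  assumes wo: "Well_order r"
    and cnt: "\<And>\<beta>. countable (underS r \<beta>)"
  obtains e :: "'a \<Rightarrow> 'a \<Rightarrow> nat"
  where "\<And>\<beta> m. finite {\<alpha> \<in> underS r \<beta>. e \<alpha> \<beta> \<le> m}"
    and "\<And>\<gamma> \<beta>. (\<gamma>, \<beta>) \<in> r \<Longrightarrow> finite {\<alpha> \<in> underS r \<gamma>. e \<alpha> \<gamma> \<noteq> e \<alpha> \<beta>}"
proof -
  have WF: "wf (r - Id)"
    using wo by (simp add: well_order_on_def)
  define f where "f \<beta> = from_nat_into (underS r \<beta>)" for \<beta>
  define L where "L \<alpha> \<beta> = (LEAST n. (\<alpha>, f \<beta> n) \<in> r)" for \<alpha> \<beta>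
  \<comment> \<open>\<open>h\<close> stands for the values at smaller second arguments. The value 0
    on the diagonal ends the walk once it reaches \<alpha>.\<close>
  define F where
    "F h \<beta> \<alpha> = (if \<alpha> = \<beta> then 0 else max (L \<alpha> \<beta>) (h (f \<beta> (L \<alpha> \<beta>)) \<alpha>))"
    for h :: "'a \<Rightarrow> 'a \<Rightarrow> nat" and \<beta> \<alpha>
  define e where "e \<alpha> \<beta> = wfrec (r - Id) F \<beta> \<alpha>" for \<alpha> \<beta>
  have f_underS: "f \<beta> n \<in> underS r \<beta>" if "\<alpha> \<in> underS r \<beta>" for \<alpha> \<beta> n
    unfolding f_def using that by (intro from_nat_into) auto
  have f_surj: "\<exists>n. f \<beta> n = \<alpha>" if "\<alpha> \<in> underS r \<beta>" for \<alpha> \<beta>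
    unfolding f_def using from_nat_into_surj[OF cnt that] .
  have refl: "(\<alpha>, \<alpha>) \<in> r" if "\<alpha> \<in> underS r \<beta>" for \<alpha> \<beta>
    using that wo by (auto simp: order_on_defs refl_on_def underS_def Field_def)
  have L: "(\<alpha>, f \<beta> (L \<alpha> \<beta>)) \<in> r" if "\<alpha> \<in> underS r \<beta>" for \<alpha> \<beta>
    unfolding L_def by (rule LeastI_ex) (metis f_surj refl that)
  have L_le: "L \<alpha> \<beta> \<le> n" if "(\<alpha>, f \<beta> n) \<in> r" for \<alpha> \<beta> n
    unfolding L_def using that by (rule Least_le)
  have e_rec: "e \<alpha> \<beta> = max (L \<alpha> \<beta>) (e \<alpha> (f \<beta> (L \<alpha> \<beta>)))" if "\<alpha> \<in> underS r \<beta>" for \<alpha> \<beta>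
  proof -
    \<comment> \<open>The recursive call is made strictly below \<beta>, where the cut in
      \<open>wfrec\<close> does not alter values.\<close>
    have "(f \<beta> (L \<alpha> \<beta>), \<beta>) \<in> r - Id"
      using f_underS[OF that] by (auto simp: underS_def)
    moreover have "\<alpha> \<noteq> \<beta>"
      using that by (simp add: underS_def)
    ultimately show ?thesis
      unfolding e_def wfrec[OF WF, of F \<beta>] by (simp add: F_def cut_apply)
  qed
  \<comment> \<open>Both properties go through one induction, because coherence at \<beta> relies on
    finiteness below \<beta>.\<close>
  have *: "(\<forall>m. finite {\<alpha> \<in> underS r \<beta>. e \<alpha> \<beta> \<le> m}) \<and>
      (\<forall>\<gamma> \<in> underS r \<beta>. finite {\<alpha> \<in> underS r \<gamma>. e \<alpha> \<gamma> \<noteq> e \<alpha> \<beta>})" for \<beta>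
  proof (induction \<beta> rule: wf_induct_rule[OF WF])
    case (1 \<beta>)
    have fin: "finite {\<alpha> \<in> underS r \<gamma>. e \<alpha> \<gamma> \<le> m}" if "\<gamma> \<in> underS r \<beta>" for \<gamma> m
      using 1[of \<gamma>] that by (auto simp: underS_def)
    \<comment> \<open>A symmetric form of the induction hypothesis: the point
      \<open>f \<beta> n\<close> met later may lie on either side of \<gamma>.\<close>
    have coh: "finite {\<alpha> \<in> underS r \<gamma> \<inter> underS r \<delta>. e \<alpha> \<gamma> \<noteq> e \<alpha> \<delta>}"
      if "\<gamma> \<in> underS r \<beta>" "\<delta> \<in> underS r \<beta>" for \<gamma> \<delta>
    proof -
      consider "\<gamma> = \<delta>" | "\<gamma> \<in> underS r \<delta>" | "\<delta> \<in> underS r \<gamma>"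
        using underS_linear[OF wo \<open>\<gamma> \<in> underS r \<beta>\<close> \<open>\<delta> \<in> underS r \<beta>\<close>] by blast
      then show ?thesis
      proof cases
        case 2
        then have "finite {\<alpha> \<in> underS r \<gamma>. e \<alpha> \<gamma> \<noteq> e \<alpha> \<delta>}"
          using 1[of \<delta>] that by (auto simp: underS_def)
        then show ?thesis by (rule rev_finite_subset) auto
      next
        case 3
        then have "finite {\<alpha> \<in> underS r \<delta>. e \<alpha> \<delta> \<noteq> e \<alpha> \<gamma>}"
          using 1[of \<gamma>] that by (auto simp: underS_def)
        then show ?thesis by (rule rev_finite_subset) auto
      qed simp
    qed
    show ?case
    proof (intro conjI allI ballI)
      fix m
      \<comment> \<open>A bound \<open>m\<close> on the maximum bounds both the index of the first
        step and the value at the point \<open>f \<beta> n\<close> reached by it.\<close>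
      let ?B = "\<Union>n\<le>m. insert (f \<beta> n) {\<alpha> \<in> underS r (f \<beta> n). e \<alpha> (f \<beta> n) \<le> m}"
      show "finite {\<alpha> \<in> underS r \<beta>. e \<alpha> \<beta> \<le> m}"
      proof (cases "underS r \<beta> = {}")
        case False
        then have "f \<beta> n \<in> underS r \<beta>" for n
          using f_underS by auto
        then have "finite ?B"
          using fin by simp
        moreover have "{\<alpha> \<in> underS r \<beta>. e \<alpha> \<beta> \<le> m} \<subseteq> ?B"
        proof safe
          fix \<alpha> assume \<alpha>: "\<alpha> \<in> underS r \<beta>" "e \<alpha> \<beta> \<le> m"
          then have "L \<alpha> \<beta> \<le> m" "e \<alpha> (f \<beta> (L \<alpha> \<beta>)) \<le> m"
            using e_rec[of \<alpha> \<beta>] by auto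
          with L[OF \<alpha>(1)] show "\<alpha> \<in> ?B"
            by (auto simp: underS_def)
        qed
        ultimately show ?thesis
          by (rule finite_subset[rotated])
      qed simp
    next
      fix \<gamma> assume \<gamma>: "\<gamma> \<in> underS r \<beta>"
      then obtain N where N: "f \<beta> N = \<gamma>"
        using f_surj by blast
      \<comment> \<open>For \<alpha> below \<open>\<gamma> = f \<beta> N\<close> the first step has
        index \<open>n \<le> N\<close>. A disagreement then has one of three causes: the walk ends
        at \<open>f \<beta> n\<close>, the values at \<gamma> and at \<open>f \<beta> n\<close>
        differ, or the index \<open>n\<close> dominates the maximum.\<close>
      let ?B = "\<lambda>n. insert (f \<beta> n)
        ({\<alpha> \<in> underS r \<gamma> \<inter> underS r (f \<beta> n). e \<alpha> \<gamma> \<noteq> e \<alpha> (f \<beta> n)} \<union>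
         {\<alpha> \<in> underS r (f \<beta> n). e \<alpha> (f \<beta> n) \<le> n})"
      have "finite (\<Union>n\<le>N. ?B n)"
        using fin coh \<gamma> f_underS[OF \<gamma>] by simp
      moreover have "{\<alpha> \<in> underS r \<gamma>. e \<alpha> \<gamma> \<noteq> e \<alpha> \<beta>} \<subseteq> (\<Union>n\<le>N. ?B n)"
      proof safe
        fix \<alpha> assume \<alpha>: "\<alpha> \<in> underS r \<gamma>" and ne: "e \<alpha> \<gamma> \<noteq> e \<alpha> \<beta>"
        have \<alpha>\<beta>: "\<alpha> \<in> underS r \<beta>"
          using underS_trans[OF wo \<alpha> \<gamma>] .
        have "L \<alpha> \<beta> \<le> N"
          using \<alpha> N by (intro L_le) (auto simp: underS_def)
        moreover have "\<alpha> \<in> ?B (L \<alpha> \<beta>)"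
          using L[OF \<alpha>\<beta>] ne e_rec[OF \<alpha>\<beta>] \<alpha> by (auto simp: underS_def max_def split: if_splits)
        ultimately show "\<alpha> \<in> (\<Union>n\<le>N. ?B n)"
          by blast
      qed
      ultimately show "finite {\<alpha> \<in> underS r \<gamma>. e \<alpha> \<gamma> \<noteq> e \<alpha> \<beta>}"
        by (rule finite_subset[rotated])
    qed
  qed
  show thesis
  proof (rule that)
    show "finite {\<alpha> \<in> underS r \<beta>. e \<alpha> \<beta> \<le> m}" for \<beta> m
      using * by blast
    show "finite {\<alpha> \<in> underS r \<gamma>. e \<alpha> \<gamma> \<noteq> e \<alpha> \<beta>}" if "(\<gamma>, \<beta>) \<in> r" for \<gamma> \<beta>
      using *[of \<beta>] that by (cases "\<gamma> = \<beta>") (auto simp: underS_def)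
  qed
qed

text \<open>Each set on which \<open>e\<close> is constant in its first argument is finite, so the
  count of earlier members strictly increases along it and separates its points. Adding the count
  keeps coherence, since a finite disagreement of \<open>e\<close> affects only finitely many
  counts.\<close>

lemma ex_coherent_injections:
  fixes r :: "'a rel"
  assumes wo: "Well_order r"
    and cnt: "\<And>\<beta>. countable (underS r \<beta>)"
  obtains p :: "'a \<times> 'a \<Rightarrow> nat"
  where "\<And>\<beta>. inj_on (\<lambda>\<alpha>. p (\<alpha>, \<beta>)) (underS r \<beta>)"
    and "\<And>\<gamma> \<beta>. (\<gamma>, \<beta>) \<in> r \<Longrightarrow> finite {\<alpha> \<in> underS r \<gamma>. p (\<alpha>, \<gamma>) \<noteq> p (\<alpha>, \<beta>)}"
proof -
  obtain e :: "'a \<Rightarrow> 'a \<Rightarrow> nat"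
    where fin: "\<And>\<beta> m. finite {\<alpha> \<in> underS r \<beta>. e \<alpha> \<beta> \<le> m}"
      and coh: "\<And>\<gamma> \<beta>. (\<gamma>, \<beta>) \<in> r \<Longrightarrow> finite {\<alpha> \<in> underS r \<gamma>. e \<alpha> \<gamma> \<noteq> e \<alpha> \<beta>}"
    using ex_coherent_finite_to_one[OF wo cnt] by blast
  define S where "S \<alpha> \<beta> = {\<alpha>' \<in> underS r \<alpha>. e \<alpha>' \<beta> = e \<alpha> \<beta>}" for \<alpha> \<beta>
  define p where "p = (\<lambda>(\<alpha>, \<beta>). prod_encode (e \<alpha> \<beta>, card (S \<alpha> \<beta>)))"
  note trans = underS_trans[OF wo]
  have neq: "p (\<alpha>, \<beta>) \<noteq> p (\<alpha>', \<beta>)" if "\<alpha> \<in> underS r \<alpha>'" "\<alpha>' \<in> underS r \<beta>" for \<alpha> \<alpha>' \<beta>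
  proof
    assume "p (\<alpha>, \<beta>) = p (\<alpha>', \<beta>)"
    then have eq: "e \<alpha> \<beta> = e \<alpha>' \<beta>" and card: "card (S \<alpha> \<beta>) = card (S \<alpha>' \<beta>)"
      by (auto simp: p_def)
    have "finite (S \<alpha>' \<beta>)"
      by (rule finite_subset[OF _ fin[of \<beta> "e \<alpha>' \<beta>"]])
        (use trans[OF _ that(2)] in \<open>auto simp: S_def\<close>)
    moreover have "\<alpha> \<in> S \<alpha>' \<beta>" "\<alpha> \<notin> S \<alpha> \<beta>"
      using that eq by (auto simp: S_def underS_def)
    moreover have "S \<alpha> \<beta> \<subseteq> S \<alpha>' \<beta>"
      using eq trans[OF _ that(1)] by (auto simp: S_def)
    ultimately have "card (S \<alpha> \<beta>) < card (S \<alpha>' \<beta>)"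
      by (intro psubset_card_mono) auto
    with card show False by simp
  qed
  show thesis
  proof (rule that)
    show "inj_on (\<lambda>\<alpha>. p (\<alpha>, \<beta>)) (underS r \<beta>)" for \<beta>
    proof (rule inj_onI, rule ccontr)
      fix \<alpha> \<alpha>' assume *: "\<alpha> \<in> underS r \<beta>" "\<alpha>' \<in> underS r \<beta>" "p (\<alpha>, \<beta>) = p (\<alpha>', \<beta>)" "\<alpha> \<noteq> \<alpha>'"
      then have "\<alpha> \<in> underS r \<alpha>' \<or> \<alpha>' \<in> underS r \<alpha>"
        using underS_linear[OF wo] by blast
      with * neq[of \<alpha> \<alpha>' \<beta>] neq[of \<alpha>' \<alpha> \<beta>] show False by auto
    qed
    fix \<gamma> \<beta> assume "(\<gamma>, \<beta>) \<in> r"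
    define D where "D = {\<alpha> \<in> underS r \<gamma>. e \<alpha> \<gamma> \<noteq> e \<alpha> \<beta>}"
    have "finite D"
      unfolding D_def by (rule coh) fact
    \<comment> \<open>The values that either function takes on the disagreement set. If \<alpha> is
      outside \<open>D\<close> and its value is outside \<open>V\<close>, no point of
      \<open>D\<close> is counted in \<open>S \<alpha> \<gamma>\<close> or
      \<open>S \<alpha> \<beta>\<close>, so these sets coincide.\<close>
    define V where "V = (\<lambda>\<alpha>. e \<alpha> \<gamma>) ` D \<union> (\<lambda>\<alpha>. e \<alpha> \<beta>) ` D"
    have "finite V"
      using \<open>finite D\<close> by (simp add: V_def)
    have "finite (D \<union> (\<Union>v\<in>V. {\<alpha> \<in> underS r \<gamma>. e \<alpha> \<gamma> \<le> v}))"
      using \<open>finite D\<close> \<open>finite V\<close> fin by simp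
    moreover have "{\<alpha> \<in> underS r \<gamma>. p (\<alpha>, \<gamma>) \<noteq> p (\<alpha>, \<beta>)} \<subseteq>
        D \<union> (\<Union>v\<in>V. {\<alpha> \<in> underS r \<gamma>. e \<alpha> \<gamma> \<le> v})"
    proof (safe del: UN_E)
      fix \<alpha> assume \<alpha>: "\<alpha> \<in> underS r \<gamma>" "p (\<alpha>, \<gamma>) \<noteq> p (\<alpha>, \<beta>)"
        and "\<alpha> \<notin> (\<Union>v\<in>V. {\<alpha> \<in> underS r \<gamma>. e \<alpha> \<gamma> \<le> v})"
      then have notV: "e \<alpha> \<gamma> \<notin> V" by auto
      show "\<alpha> \<in> D"
      proof (rule ccontr)
        assume "\<alpha> \<notin> D"
        then have eq: "e \<alpha> \<gamma> = e \<alpha> \<beta>"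
          using \<alpha> by (simp add: D_def)
        have "e \<alpha>' \<gamma> = e \<alpha> \<gamma> \<longleftrightarrow> e \<alpha>' \<beta> = e \<alpha> \<beta>" if "\<alpha>' \<in> underS r \<alpha>" for \<alpha>'
        proof (cases "\<alpha>' \<in> D")
          case True
          then have "e \<alpha>' \<gamma> \<in> V" "e \<alpha>' \<beta> \<in> V" by (auto simp: V_def)
          with notV eq show ?thesis by metis
        next
          case False
          with trans[OF that \<alpha>(1)] eq show ?thesis by (simp add: D_def)
        qed
        then have "S \<alpha> \<gamma> = S \<alpha> \<beta>"
          by (auto simp: S_def)
        with eq \<alpha> show False by (simp add: p_def)
      qed
    qed
    ultimately show "finite {\<alpha> \<in> underS r \<gamma>. p (\<alpha>, \<gamma>) \<noteq> p (\<alpha>, \<beta>)}"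
      by (rule finite_subset[rotated])
  qed
qed

section \<open>Countable segments, truncations, and sets of order type omega + k\<close>

lemma countable_underS_omega1: "countable (underS omega1 \<beta>)"
proof (cases "\<beta> \<in> Field omega1")
  case True
  then have "|underS omega1 \<beta>| <o cardSuc natLeq"
    using card_of_underS[OF Card_order_omega1] by (simp add: omega1_def)
  then have "|underS omega1 \<beta>| \<le>o natLeq"
    using cardSuc_ordLeq_ordLess[OF natLeq_Card_order card_of_Card_order] by blast
  then have "|underS omega1 \<beta>| \<le>o |UNIV :: nat set|"
    using card_of_nat ordIso_symmetric ordLeq_ordIso_trans by blast
  then show ?thesis
    by (auto simp: countable_def simp flip: card_of_ordLeq)
qed (simp add: underS_empty)

text \<open>Two distinct sets differ at some number. Choosing one such number for each of the
  finitely many pairs, any strict upper bound of the choices serves as \<open>N\<close>.\<close>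

lemma ex_truncation_inj_on:
  fixes B :: "nat set set"
  assumes "finite B"
  obtains N where "\<And>n. n \<ge> N \<Longrightarrow> inj_on (\<lambda>A. A \<inter> {..<n}) B"
proof -
  have "\<exists>m. A \<noteq> A' \<longrightarrow> (m \<in> A) \<noteq> (m \<in> A')" for A A' :: "nat set"
    by blast
  then obtain d where d: "\<And>A A' :: nat set. A \<noteq> A' \<Longrightarrow> (d A A' \<in> A) \<noteq> (d A A' \<in> A')"
    by metis
  have "finite ((\<lambda>(A, A'). d A A') ` (B \<times> B))"
    using assms by simp
  then obtain N where "\<forall>m \<in> (\<lambda>(A, A'). d A A') ` (B \<times> B). m < N"
    unfolding finite_nat_set_iff_bounded by (elim exE)
  then have N: "d A A' < N" if "A \<in> B" "A' \<in> B" for A A'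
    using that by blast
  show thesis
  proof (rule that[of N], rule inj_onI, rule ccontr)
    fix n A A' assume *: "n \<ge> N" "A \<in> B" "A' \<in> B" "A \<inter> {..<n} = A' \<inter> {..<n}" "A \<noteq> A'"
    then have "d A A' < n"
      using N[of A A'] by simp
    with * d[of A A'] show False by blast
  qed
qed

text \<open>Reads off from the isomorphism an infinite set of points \<open>x n\<close> (images of
  \<open>Inl n\<close>) below all of the top points \<open>b i\<close> (images of
  \<open>Inr i\<close>).\<close>

lemma has_order_type_omega_plusE:
  fixes r :: "'a rel"
  assumes "has_order_type r X (omega_plus k)"
  obtains x b :: "nat \<Rightarrow> 'a" where "inj x" "inj_on b {..<k}" "range x \<subseteq> X" "b ` {..<k} \<subseteq> X"
    "\<And>n i. i < k \<Longrightarrow> x n \<in> underS r (b i)"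
    "\<And>i i'. i \<le> i' \<Longrightarrow> i' < k \<Longrightarrow> (b i, b i') \<in> r"
proof -
  have "omega_plus k =o Restr r X"
    using assms by (auto simp: has_order_type_def intro: ordIso_symmetric)
  then obtain f where f: "iso (omega_plus k) (Restr r X) f"
    by (auto simp: ordIso_def)
  then have inj: "inj_on f (Field (omega_plus k))"
    and mono: "\<And>u v. (u, v) \<in> omega_plus k \<Longrightarrow> (f u, f v) \<in> Restr r X"
    using Well_order_omega_plus[of k] by (auto simp: iso_iff2 bij_betw_def dest: FieldI1 FieldI2)
  show thesis
  proof (rule that[of "\<lambda>n. f (Inl n)" "\<lambda>i. f (Inr i)"])
    show "inj (\<lambda>n. f (Inl n))" "inj_on (\<lambda>i. f (Inr i)) {..<k}"
      using inj by (auto simp: inj_on_def Field_omega_plus)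
    show "range (\<lambda>n. f (Inl n)) \<subseteq> X"
      using mono[of "Inl _" "Inl _"] by (auto simp: omega_plus_def)
    show "(\<lambda>i. f (Inr i)) ` {..<k} \<subseteq> X"
      using mono[of "Inr _" "Inr _"] by (auto simp: omega_plus_def)
    show "f (Inl n) \<in> underS r (f (Inr i))" if "i < k" for n i
    proof -
      have "f (Inl n) \<noteq> f (Inr i)"
        using inj_onD[OF inj, of "Inl n" "Inr i"] that by (auto simp: Field_omega_plus)
      then show ?thesis
        using mono[of "Inl n" "Inr i"] that by (auto simp: omega_plus_def underS_def)
    qed
    show "(f (Inr i), f (Inr i')) \<in> r" if "i \<le> i'" "i' < k" for i i'
      using mono[of "Inr i" "Inr i'"] that by (auto simp: omega_plus_def)
  qed
qed

section \<open>The partition and the coloring on omega_1\<close>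

theorem theorem3p8:
  shows "\<exists>(p :: nat set \<times> nat set \<Rightarrow> nat) (c :: nat set \<times> nat set \<Rightarrow> nat).
    injective_fibers omega1 p \<and>
    (\<forall>(k::nat) X. has_order_type omega1 X (omega_plus k) \<longrightarrow>
      (\<exists>j. |{..<k}| \<le>o |{c (\<alpha>, \<beta>) | \<alpha> \<beta>. (\<alpha>, \<beta>) \<in> inc_pairs omega1 X \<and> p (\<alpha>, \<beta>) = j}| ))"
proof -
  have wo: "Well_order omega1"
    using Card_order_omega1 by (rule card_order_on_well_order_on)
  obtain p :: "nat set \<times> nat set \<Rightarrow> nat"
    where inj: "\<And>\<beta>. inj_on (\<lambda>\<alpha>. p (\<alpha>, \<beta>)) (underS omega1 \<beta>)"
      and coh: "\<And>\<gamma> \<beta>. (\<gamma>, \<beta>) \<in> omega1 \<Longrightarrow>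
        finite {\<alpha> \<in> underS omega1 \<gamma>. p (\<alpha>, \<gamma>) \<noteq> p (\<alpha>, \<beta>)}"
    using ex_coherent_injections[OF wo countable_underS_omega1] by blast
  \<comment> \<open>The points of \<open>\<omega>\<^sub>1\<close> are themselves sets of natural numbers, so \<open>\<beta>\<close> can serve as \<open>r\<^sub>\<beta>\<close>.\<close>
  define c where "c = (\<lambda>(\<alpha>, \<beta>). set_encode (\<beta> \<inter> {..<p (\<alpha>, \<beta>)}))"
  have "injective_fibers omega1 p"
    unfolding injective_fibers_def
  proof (intro allI impI)
    fix \<alpha> \<alpha>' \<beta> assume *: "(\<alpha>, \<alpha>') \<in> omega1 - Id" "(\<alpha>', \<beta>) \<in> omega1 - Id"
    then have "\<alpha> \<in> underS omega1 \<alpha>'" "\<alpha>' \<in> underS omega1 \<beta>" "\<alpha> \<noteq> \<alpha>'"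
      by (auto simp: underS_def)
    moreover from this have "\<alpha> \<in> underS omega1 \<beta>"
      using underS_trans[OF wo] by blast
    ultimately show "p (\<alpha>, \<beta>) \<noteq> p (\<alpha>', \<beta>)"
      using inj_onD[OF inj] by blast
  qed
  moreover have "\<exists>j. |{..<k}| \<le>o
      |{c (\<alpha>, \<beta>) | \<alpha> \<beta>. (\<alpha>, \<beta>) \<in> inc_pairs omega1 X \<and> p (\<alpha>, \<beta>) = j}|"
    if X: "has_order_type omega1 X (omega_plus k)" for k X
  \<comment> \<open>The main case compares all \<open>b i\<close> with the least one,
    \<open>b 0\<close>, which is available only for positive \<open>k\<close>.\<close>
  proof (cases "k = 0")
    case True
    then show ?thesis by (simp add: card_of_empty)
  next
    case False
    obtain x b :: "nat \<Rightarrow> nat set"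
      where inj_x: "inj x" and inj_b: "inj_on b {..<k}"
      and x: "range x \<subseteq> X" and b: "b ` {..<k} \<subseteq> X"
      and xb: "\<And>n i. i < k \<Longrightarrow> x n \<in> underS omega1 (b i)"
      and bb: "\<And>i i'. i \<le> i' \<Longrightarrow> i' < k \<Longrightarrow> (b i, b i') \<in> omega1"
      using has_order_type_omega_plusE[OF X] by blast
    obtain N where N: "\<And>n. n \<ge> N \<Longrightarrow> inj_on (\<lambda>A. A \<inter> {..<n}) (b ` {..<k})"
      by (rule ex_truncation_inj_on[of "b ` {..<k}"]) auto
    \<comment> \<open>Two kinds of bad points below \<open>b 0\<close>: injectivity leaves finitely
      many with a value below \<open>N\<close>, coherence finitely many where some
      \<open>b i\<close> gives another value than \<open>b 0\<close>. The infinitely many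
      \<open>x n\<close> cannot all be bad.\<close>
    have "finite {\<alpha> \<in> underS omega1 (b 0). p (\<alpha>, b 0) < N}"
      using finite_vimage_IntI[OF finite_lessThan[of N] inj[of "b 0"]]
      by (rule rev_finite_subset) auto
    moreover have "finite {\<alpha> \<in> underS omega1 (b 0). p (\<alpha>, b 0) \<noteq> p (\<alpha>, b i)}" if "i < k" for i
      using coh bb[of 0 i] that by simp
    ultimately have "finite ({\<alpha> \<in> underS omega1 (b 0). p (\<alpha>, b 0) < N} \<union>
        (\<Union>i<k. {\<alpha> \<in> underS omega1 (b 0). p (\<alpha>, b 0) \<noteq> p (\<alpha>, b i)}))" (is "finite ?B")
      by simp
    moreover have "infinite (range x)"
      using inj_x range_inj_infinite by blast
    ultimately have "\<not> range x \<subseteq> ?B"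
      using finite_subset by blast
    then obtain n where n: "x n \<notin> ?B"
      by (auto simp del: Un_iff)
    define j where "j = p (x n, b 0)"
    have "x n \<in> underS omega1 (b 0)"
      using xb False by simp
    with n have "j \<ge> N" and p: "\<And>i. i < k \<Longrightarrow> p (x n, b i) = j"
      by (simp_all add: j_def)
    have "inj_on (\<lambda>i. c (x n, b i)) {..<k}"
    proof (rule inj_onI)
      fix i i' assume i: "i \<in> {..<k}" "i' \<in> {..<k}" and "c (x n, b i) = c (x n, b i')"
      \<comment> \<open>Both truncations are at the common value \<open>j\<close>, and
        \<open>set_encode\<close> is injective on finite sets.\<close>
      then have "b i \<inter> {..<j} = b i' \<inter> {..<j}"
        using p by (simp add: c_def set_encode_eq)
      then have "b i = b i'"
        using inj_onD[OF N[OF \<open>j \<ge> N\<close>]] i by blast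
      with inj_b i show "i = i'"
        by (auto dest: inj_onD)
    qed
    moreover have "(x n, b i) \<in> inc_pairs omega1 X" if "i < k" for i
      using x b xb[OF that, of n] that by (auto simp: inc_pairs_def underS_def)
    ultimately show ?thesis
      using p by (intro exI[of _ j] card_of_ordLeqI) auto
  qed
  ultimately show ?thesis by blast
qed

end
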